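(* Let $H$ be a graph with $h$ vertices, and let $n,s,k$ be nonnegative integers with $0\leq s\leq n$. Then $\alpha_k(O_n\cup H)=0$ if $k<\chi(H)$ or $k>n+h$, and for $\chi(H)\leq k\leq n+h$, \[ \alpha_k(O_n\cup H)=\sum_{j=\chi(H)}^{k}{s+j \brace k}_{\!j}\,\alpha_j(O_{n-s}\cup H). \] In particular, for $s=n$, \[ \alpha_k(O_n\cup H)=\sum_{j=\chi(H)}^{k}{n+j \brace k}_{\!j}\,\alpha_j(H), \] and, for $s=1$, \[ \alpha_k(O_n\cup H)=k\,\alpha_k(O_{n-1}\cup H)+\alpha_{k-1}(O_{n-1}\cup H),\qquad n\geq 1. \]
   Context: All graphs are finite and simple. For a graph $G=(V,E)$ and an integer $k\ge 0$, $\alpha_k(G)$ denotes the number of partitions of $V$ into $k$ nonempty independent sets (so $\alpha_k(G)=0$ for $k$ outside $[\chi(G),|V|]$), where $\chi(G)$ is the chromatic number. $O_n$ ($n\ge1$) is the graph with $n$ vertices and no edges, and $O_0$ is the graph with no vertices. For graphs $G_1,G_2$ on disjoint vertex sets, $G_1\cup G_2$ is their disjoint union. The $r$-Stirling number of the second kind ${m \brace k}_{r}$ is the number of partitions of $\{1,\dots,m\}$ into $k$ nonempty blocks such that $1,2,\dots,r$ lie in distinct blocks. *)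

theory Defs
  imports "Graph_Theory.Pair_Digraph" "HOL-Library.Disjoint_Sets"
begin

text \<open>
  Finite simple graphs are the \<open>pair_graph\<close>s of \<open>Graph_Theory\<close>: an edge \<open>uv\<close> is represented by
  the two arcs \<open>(u, v)\<close> and \<open>(v, u)\<close>. The graph without vertices is allowed.
\<close>

definition independent_set :: "'a pair_pre_digraph \<Rightarrow> 'a set \<Rightarrow> bool" where
  "independent_set G S \<longleftrightarrow> S \<subseteq> pverts G \<and> (\<forall>u\<in>S. \<forall>v\<in>S. (u, v) \<notin> parcs G)"

definition proper_coloring :: "'a pair_pre_digraph \<Rightarrow> nat \<Rightarrow> ('a \<Rightarrow> nat) \<Rightarrow> bool" where
  "proper_coloring G c f \<longleftrightarrow>
     f ` pverts G \<subseteq> {..<c} \<and> (\<forall>(u, v)\<in>parcs G. f u \<noteq> f v)"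

definition chromatic_number :: "'a pair_pre_digraph \<Rightarrow> nat" where
  "chromatic_number G = (LEAST c. \<exists>f. proper_coloring G c f)"

definition alpha :: "nat \<Rightarrow> 'a pair_pre_digraph \<Rightarrow> nat" where
  "alpha k G = card {P. partition_on (pverts G) P \<and> card P = k \<and> (\<forall>S\<in>P. independent_set G S)}"

definition edgeless :: "nat \<Rightarrow> nat pair_pre_digraph" where
  "edgeless n = \<lparr>pverts = {1..n}, parcs = {}\<rparr>"

text \<open>The vertex sets are made disjoint by tagging the vertices with \<open>Inl\<close> and \<open>Inr\<close>.\<close>

definition disjoint_union ::
    "'a pair_pre_digraph \<Rightarrow> 'b pair_pre_digraph \<Rightarrow> ('a + 'b) pair_pre_digraph" (infixl \<open>\<uplus>\<^sub>G\<close> 65) where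
  "G \<uplus>\<^sub>G H =
     \<lparr>pverts = Inl ` pverts G \<union> Inr ` pverts H,
      parcs = map_prod Inl Inl ` parcs G \<union> map_prod Inr Inr ` parcs H\<rparr>"

text \<open>
  \<open>r_Stirling2 r m k\<close> is the \<open>r\<close>-Stirling number of the second kind with upper index \<open>m\<close>, lower
  index \<open>k\<close> and subscript \<open>r\<close>; it is meant for \<open>r \<le> m\<close>.
\<close>

definition r_Stirling2 :: "nat \<Rightarrow> nat \<Rightarrow> nat \<Rightarrow> nat" where
  "r_Stirling2 r m k =
     card {P. partition_on {1..m} P \<and> card P = k \<and>
              (\<forall>x\<in>{1..r}. \<forall>y\<in>{1..r}. x \<noteq> y \<longrightarrow> \<not> (\<exists>B\<in>P. x \<in> B \<and> y \<in> B))}"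

lemma pair_graph_edgeless: "pair_graph (edgeless n)"
  by unfold_locales (auto simp: edgeless_def symmetric_def sym_def)

lemma pair_graph_disjoint_union:
  assumes "pair_graph G" "pair_graph H"
  shows "pair_graph (G \<uplus>\<^sub>G H)"
proof -
  interpret G: pair_graph G by fact
  interpret H: pair_graph H by fact
  have "sym (parcs G)" "sym (parcs H)"
    using G.pair_sym_arcs H.pair_sym_arcs by (simp_all add: symmetric_def)
  then have "sym (parcs (G \<uplus>\<^sub>G H))"
    unfolding sym_def disjoint_union_def by fastforce
  then show ?thesis
    by unfold_locales
      (auto simp: disjoint_union_def symmetric_def
        dest: G.wellformed' H.wellformed' G.pair_no_loops H.pair_no_loops)
qed

end

theory Submission
  imports Defs
begin

text \<open>
  Adding an isolated vertex to a graph turns a partition into \<open>k\<close> independent sets into \<open>k\<close> such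
  partitions (put the vertex into an existing block) or into one partition with \<open>k + 1\<close> blocks
  (make it a block of its own). An \<open>r\<close>-Stirling number counts the partitions into independent
  sets of a clique on \<open>r\<close> vertices together with isolated vertices, so it satisfies the same
  recurrence in its upper index. The sum formula then follows by induction on \<open>s\<close>, starting from
  the fact that a clique on \<open>j\<close> vertices has exactly one such partition.
\<close>

section \<open>Partitions with a condition on blocks, and adding one point to them\<close>

definition partitions_with :: "('a set \<Rightarrow> bool) \<Rightarrow> 'a set \<Rightarrow> nat \<Rightarrow> 'a set set set" where
  "partitions_with J V k = {P. partition_on V P \<and> card P = k \<and> (\<forall>S\<in>P. J S)}"

lemma finite_partitions_with: "finite V \<Longrightarrow> finite (partitions_with J V k)"
  unfolding partitions_with_def
  by (rule finite_subset[OF _ finitely_many_partition_on[of V]]) auto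

text \<open>Blocks are nonempty, so each contributes at least one to the sum of the block
  sizes.\<close>

lemma partition_on_card_le:
  assumes "finite V" "partition_on V P"
  shows "card P \<le> card V"
proof -
  have fin: "finite p" "p \<noteq> {}" if "p \<in> P" for p
    using assms that by (auto simp: partition_on_def intro: finite_subset[OF Union_upper])
  have "card P = (\<Sum>p\<in>P. 1)" by simp
  also have "\<dots> \<le> (\<Sum>p\<in>P. card p)"
    by (rule sum_mono) (use fin in \<open>simp add: Suc_le_eq card_gt_0_iff\<close>)
  also have "\<dots> = card V"
    using product_partition[OF assms(2)] fin by simp
  finally show ?thesis .
qed

lemma partition_on_remove:
  assumes "partition_on V P" "S \<in> P"
  shows "partition_on (V - S) (P - {S})" "S \<subseteq> V" "S \<noteq> {}"
proof -
  have "disjnt S (\<Union>(P - {S}))"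
    using assms by (auto simp: partition_on_def disjnt_def pairwise_def)
  moreover have "partition_on V (insert S (P - {S}))"
    using assms by (simp add: insert_absorb)
  ultimately show "partition_on (V - S) (P - {S})" "S \<subseteq> V" "S \<noteq> {}"
    using partition_on_insert by metis+
qed

text \<open>Deleting and inserting the block \<open>{x}\<close> are mutually inverse;
  \<open>J {x}\<close> makes the new block admissible. This is the summand of the recurrence in
  which \<open>x\<close> is alone.\<close>

lemma partitions_with_singleton_block:
  assumes "finite V" "x \<notin> V" "J {x}"
  shows "{Q \<in> partitions_with J (insert x V) (Suc k). {x} \<in> Q} =
    insert {x} ` partitions_with J V k"
proof (intro equalityI subsetI)
  fix Q assume "Q \<in> {Q \<in> partitions_with J (insert x V) (Suc k). {x} \<in> Q}"
  then have Q: "partition_on (insert x V) Q" "card Q = Suc k" "\<forall>S\<in>Q. J S" "{x} \<in> Q"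
    by (auto simp: partitions_with_def)
  have "partition_on V (Q - {{x}})"
    using partition_on_remove(1)[OF Q(1,4)] assms(2) by simp
  then have "Q - {{x}} \<in> partitions_with J V k"
    using Q by (simp add: partitions_with_def)
  moreover have "Q = insert {x} (Q - {{x}})"
    using Q(4) by auto
  ultimately show "Q \<in> insert {x} ` partitions_with J V k" by blast
next
  fix Q assume "Q \<in> insert {x} ` partitions_with J V k"
  then obtain P where P: "Q = insert {x} P" "partition_on V P" "card P = k" "\<forall>S\<in>P. J S"
    by (auto simp: partitions_with_def)
  have "x \<notin> \<Union>P"
    using P(2) assms(2) by (simp add: partition_on_def)
  then have "partition_on (insert x V) Q" "{x} \<notin> P"
    using P(1,2) assms(2) by (auto simp: partition_on_insert)
  then show "Q \<in> {Q \<in> partitions_with J (insert x V) (Suc k). {x} \<in> Q}"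
    using P assms(1,3) finite_elements[OF assms(1) P(2)] by (simp add: partitions_with_def)
qed

text \<open>Removing \<open>x\<close> from its block leaves a partition \<open>P\<close> of
  \<open>V\<close> together with a marked block \<open>S\<close>, the one that \<open>x\<close> came
  from. The hypothesis on \<open>J\<close> keeps this block admissible in both directions.\<close>

lemma partitions_with_extended_block:
  assumes "finite V" "x \<notin> V" and J: "\<And>S. S \<subseteq> V \<Longrightarrow> J (insert x S) \<longleftrightarrow> J S"
  shows "{Q \<in> partitions_with J (insert x V) k. {x} \<notin> Q} =
    (\<lambda>(P, S). insert (insert x S) (P - {S})) ` (SIGMA P:partitions_with J V k. P)"
    (is "?L = ?f ` ?R")
proof (intro equalityI subsetI)
  fix Q assume "Q \<in> ?L"
  then have Q: "partition_on (insert x V) Q" "card Q = k" "\<forall>S\<in>Q. J S" "{x} \<notin> Q"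
    by (auto simp: partitions_with_def)
  obtain T where T: "T \<in> Q" "x \<in> T"
    using Q(1) by (auto simp: partition_on_def)
  define S where "S = T - {x}"
  have TS: "T = insert x S" "x \<notin> S" using T by (auto simp: S_def)
  \<comment> \<open>The assumption \<open>{x} \<notin> Q\<close> enters here: something remains of
    \<open>T\<close> without \<open>x\<close>.\<close>
  have S: "S \<subseteq> V" "S \<noteq> {}"
    using partition_on_remove(2)[OF Q(1) T(1)] TS T Q(4) by auto
  have rem: "partition_on (V - S) (Q - {T})"
    using partition_on_remove(1)[OF Q(1) T(1)] TS assms(2) by simp
  then have disj: "\<Union>(Q - {T}) = V - S"
    by (simp add: partition_on_def)
  \<comment> \<open>The other blocks cover only \<open>V - S\<close>, so the nonempty
    \<open>S\<close> is not among them and exchanging \<open>T\<close> for \<open>S\<close>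
    preserves the number of blocks.\<close>
  then have SQ: "S \<notin> Q - {T}" using S by blast
  define P where "P = insert S (Q - {T})"
  have "partition_on V P"
    unfolding P_def using rem disj S by (subst partition_on_insert) (auto simp: disjnt_def)
  moreover have "card P = k"
    using Q(2) T(1) SQ finite_elements[OF _ Q(1)] assms(1) card_Suc_Diff1[of Q T]
    by (simp add: P_def)
  moreover have "J S" using Q(3) T(1) TS(1) J[OF S(1)] by auto
  ultimately have "(P, S) \<in> ?R"
    using Q(3) by (auto simp: partitions_with_def P_def)
  moreover have "Q = ?f (P, S)"
    using T(1) TS(1) SQ by (auto simp: P_def)
  ultimately show "Q \<in> ?f ` ?R" by blast
next
  fix Q assume "Q \<in> ?f ` ?R"
  then obtain P S where P: "Q = insert (insert x S) (P - {S})" "partition_on V P" "card P = k"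
    "\<forall>S\<in>P. J S" "S \<in> P"
    by (auto simp: partitions_with_def)
  have x: "x \<notin> \<Union>P"
    using P(2) assms(2) by (simp add: partition_on_def)
  note rem = partition_on_remove[OF P(2,5)]
  have "\<Union>(P - {S}) = V - S" using rem(1) by (simp add: partition_on_def)
  then have "partition_on (insert x V) Q"
    unfolding P(1) using rem assms(2) by (subst partition_on_insert) (auto simp: disjnt_def)
  moreover have "insert x S \<notin> P - {S}" using x by blast
  then have "card Q = k"
    using P(1,3,5) finite_elements[OF assms(1) P(2)] card_Suc_Diff1[of P S] by simp
  moreover have "\<forall>S\<in>Q. J S" using P(1,4,5) J rem(2) by auto
  moreover have "{x} \<notin> Q" using P(1) x rem(3) P(5) by auto
  ultimately show "Q \<in> ?L" by (simp add: partitions_with_def)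
qed

text \<open>The pair can be read off the result: the only block containing \<open>x\<close> yields
  \<open>S\<close>, and putting \<open>S\<close> back in its place yields \<open>P\<close>.\<close>

lemma inj_on_extend_block:
  assumes "\<And>P. P \<in> \<P> \<Longrightarrow> x \<notin> \<Union>P"
  shows "inj_on (\<lambda>(P, S). insert (insert x S) (P - {S})) (SIGMA P:\<P>. P)"
proof (rule inj_onI, clarify)
  fix P S P' S'
  assume P: "P \<in> \<P>" "S \<in> P" "P' \<in> \<P>" "S' \<in> P'"
    and eq: "insert (insert x S) (P - {S}) = insert (insert x S') (P' - {S'})"
  have x: "x \<notin> \<Union>P" "x \<notin> \<Union>P'" using assms P by auto
  have "insert x S \<in> insert (insert x S') (P' - {S'})" using eq by blast
  then have "insert x S = insert x S'" using x(2) by blast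
  then have S: "S = S'" using x P by (metis UnionI insert_ident)
  have "insert x S \<notin> P" "insert x S \<notin> P'" using x by blast+
  then have "P - {S} = P' - {S}" using eq S by (metis Diff_iff insert_ident)
  then show "P = P' \<and> S = S'" using P S by (metis insert_Diff)
qed

text \<open>Partitions are split by whether \<open>x\<close> is alone. Otherwise each
  \<open>P\<close> offers \<open>k\<close> blocks to join. Leaving \<open>J\<close> abstract lets
  one recurrence serve both \<open>alpha\<close> and \<open>r_Stirling2\<close>; the case
  \<open>k = 0\<close> is separate because \<open>k - 1\<close> truncates there.\<close>

lemma card_partitions_with_insert:
  assumes V: "finite V" "x \<notin> V" and "J {x}"
    and J: "\<And>S. S \<subseteq> V \<Longrightarrow> J (insert x S) \<longleftrightarrow> J S"
  shows "card (partitions_with J (insert x V) k) =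
    k * card (partitions_with J V k) +
    (if k = 0 then 0 else card (partitions_with J V (k - 1)))"
proof -
  let ?Q = "partitions_with J (insert x V) k"
  have x: "x \<notin> \<Union>P" if "P \<in> partitions_with J V m" for P m
    using that V(2) by (simp add: partitions_with_def partition_on_def)
  have finP: "finite P" if "P \<in> partitions_with J V k" for P
    using that finite_elements[OF V(1)] by (auto simp: partitions_with_def)
  have "card {Q \<in> ?Q. {x} \<notin> Q} = card (SIGMA P:partitions_with J V k. P)"
    using partitions_with_extended_block[of V x J k, OF V J]
      card_image[OF inj_on_extend_block[of "partitions_with J V k" x, OF x]] by simp
  also have "\<dots> = (\<Sum>P\<in>partitions_with J V k. card P)"
    using V(1) finP by (simp add: card_SigmaI finite_partitions_with)
  also have "\<dots> = k * card (partitions_with J V k)"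
    by (simp add: partitions_with_def)
  finally have ext: "card {Q \<in> ?Q. {x} \<notin> Q} = k * card (partitions_with J V k)" .
  have sing: "card {Q \<in> ?Q. {x} \<in> Q} =
    (if k = 0 then 0 else card (partitions_with J V (k - 1)))"
  proof (cases k)
    case 0
    \<comment> \<open>Finiteness excludes an infinite \<open>Q\<close>, whose \<open>card\<close>
      would also be 0.\<close>
    have "Q = {}" if "Q \<in> ?Q" for Q
      using that 0 finite_elements[of "insert x V" Q] V(1) by (simp add: partitions_with_def)
    then have "{Q \<in> ?Q. {x} \<in> Q} = {}" by blast
    then show ?thesis using 0 by (simp only: card.empty if_True refl)
  next
    case (Suc m)
    have "inj_on (insert {x}) (partitions_with J V m)"
    proof (rule inj_onI)
      fix P P' assume "P \<in> partitions_with J V m" "P' \<in> partitions_with J V m"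
        and eq: "insert {x} P = insert {x} P'"
      then have "{x} \<notin> P" "{x} \<notin> P'" using x by blast+
      then show "P = P'" using eq by (simp add: insert_ident)
    qed
    then show ?thesis
      using Suc partitions_with_singleton_block[of V x J m] assms by (simp add: card_image)
  qed
  have "?Q = {Q \<in> ?Q. {x} \<notin> Q} \<union> {Q \<in> ?Q. {x} \<in> Q}" by blast
  then have "card ?Q = card {Q \<in> ?Q. {x} \<notin> Q} + card {Q \<in> ?Q. {x} \<in> Q}"
    using card_Un_disjoint[of "{Q \<in> ?Q. {x} \<notin> Q}" "{Q \<in> ?Q. {x} \<in> Q}"]
      finite_partitions_with[of "insert x V" J k] V(1) by fastforce
  then show ?thesis using ext sing by simp
qed

section \<open>Independent-set partitions and r-Stirling numbers as instances\<close>

lemma alpha_eq_card_partitions_with: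
  "alpha k G = card (partitions_with (\<lambda>S. \<forall>u\<in>S. \<forall>v\<in>S. (u, v) \<notin> parcs G) (pverts G) k)"
  unfolding alpha_def partitions_with_def independent_set_def
  \<comment> \<open>The inclusion of blocks in \<open>pverts G\<close> is automatic in a
    partition.\<close>
  by (rule arg_cong[where f = card]) (auto simp: partition_on_def)

text \<open>Separation of \<open>1, ..., r\<close> becomes a condition on single blocks:
  independence with respect to a clique on \<open>{1..r}\<close>.\<close>

lemma r_Stirling2_eq_card_partitions_with:
  "r_Stirling2 r m k =
    card (partitions_with (\<lambda>S. \<forall>u\<in>S. \<forall>v\<in>S. u \<in> {1..r} \<and> v \<in> {1..r} \<longrightarrow> u = v) {1..m} k)"
  unfolding r_Stirling2_def partitions_with_def
  by (rule arg_cong[where f = card]) blast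

text \<open>Since \<open>r \<le> m\<close>, the new point \<open>Suc m\<close> lies outside
  \<open>{1..r}\<close> and acts as an isolated vertex.\<close>

lemma r_Stirling2_Suc:
  assumes "r \<le> m"
  shows "r_Stirling2 r (Suc m) k =
    k * r_Stirling2 r m k + (if k = 0 then 0 else r_Stirling2 r m (k - 1))"
proof -
  have "{1..Suc m} = insert (Suc m) {1..m}" by auto
  then show ?thesis
    unfolding r_Stirling2_eq_card_partitions_with
    using assms by (simp only:, intro card_partitions_with_insert) auto
qed

text \<open>With all points pairwise separated, only the partition into singletons remains. This
  provides the case \<open>s = 0\<close> of the sum formula.\<close>

lemma r_Stirling2_self: "r_Stirling2 r r k = (if k = r then 1 else 0)"
proof -
  let ?S = "(\<lambda>x. {x}) ` {1..r}"
  define sep where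
    "sep P \<longleftrightarrow> (\<forall>x\<in>{1..r}. \<forall>y\<in>{1..r}. x \<noteq> y \<longrightarrow> \<not> (\<exists>B\<in>P. x \<in> B \<and> y \<in> B))" for P
  have eq: "P = ?S" if P: "partition_on {1..r} P" and "sep P" for P
  proof -
    have sing: "B = {x}" if "B \<in> P" "x \<in> B" for B x
      using that P \<open>sep P\<close> unfolding partition_on_def sep_def by blast
    have "B \<in> ?S" if "B \<in> P" for B
    proof -
      obtain x where "x \<in> B" using \<open>B \<in> P\<close> partition_onD3[OF P] by fastforce
      then have "B = {x}" "x \<in> {1..r}"
        using sing \<open>B \<in> P\<close> partition_onD1[OF P] by blast+
      then show ?thesis by blast
    qed
    moreover have "{x} \<in> P" if "x \<in> {1..r}" for x
    proof -
      obtain B where "B \<in> P" "x \<in> B"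
        using \<open>x \<in> {1..r}\<close> partition_onD1[OF P] by blast
      then show ?thesis using sing by blast
    qed
    ultimately show ?thesis by blast
  qed
  have "sep ?S" by (auto simp: sep_def)
  then have "partition_on {1..r} P \<and> card P = k \<and> sep P \<longleftrightarrow> P = ?S \<and> card P = k" for P
    using eq[of P] partition_on_singletons[of "{1..r}"] by blast
  then have "{P. partition_on {1..r} P \<and> card P = k \<and> sep P} = {P. P = ?S \<and> card P = k}"
    by simp
  also have "\<dots> = (if k = r then {?S} else {})"
    by (auto simp: card_image)
  finally show ?thesis unfolding r_Stirling2_def sep_def[symmetric] by simp
qed

section \<open>Adding isolated vertices to \<open>H\<close>\<close>

lemma alpha_edgeless_Suc:
  assumes "finite (pverts H)"
  shows "alpha k (edgeless (Suc n) \<uplus>\<^sub>G H) =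
    k * alpha k (edgeless n \<uplus>\<^sub>G H) +
    (if k = 0 then 0 else alpha (k - 1) (edgeless n \<uplus>\<^sub>G H))"
proof -
  \<comment> \<open>No arc touches a vertex tagged \<open>Inl\<close>, so joining one to a block
    does not affect independence.\<close>
  have isolated: "(Inl i, v) \<notin> parcs (edgeless n \<uplus>\<^sub>G H)"
    "(v, Inl i) \<notin> parcs (edgeless n \<uplus>\<^sub>G H)" for v i
    by (auto simp: disjoint_union_def edgeless_def)
  have "finite (pverts (edgeless n \<uplus>\<^sub>G H))" "Inl (Suc n) \<notin> pverts (edgeless n \<uplus>\<^sub>G H)"
    using assms by (auto simp: disjoint_union_def edgeless_def)
  moreover have "pverts (edgeless (Suc n) \<uplus>\<^sub>G H) = insert (Inl (Suc n)) (pverts (edgeless n \<uplus>\<^sub>G H))"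
    "parcs (edgeless (Suc n) \<uplus>\<^sub>G H) = parcs (edgeless n \<uplus>\<^sub>G H)"
    by (auto simp: disjoint_union_def edgeless_def)
  ultimately show ?thesis
    unfolding alpha_eq_card_partitions_with
    by (simp only:, intro card_partitions_with_insert) (auto simp: isolated)
qed

text \<open>Both sides obey the same recurrence in \<open>s\<close>. The bound \<open>K\<close> is
  kept apart from \<open>k\<close> so that the induction hypotheses at \<open>k\<close> and
  \<open>k - 1\<close> have the same summation range.\<close>

lemma alpha_edgeless_add:
  assumes "finite (pverts H)" "k \<le> K"
  shows "alpha k (edgeless (s + m) \<uplus>\<^sub>G H) =
    (\<Sum>j\<le>K. r_Stirling2 j (s + j) k * alpha j (edgeless m \<uplus>\<^sub>G H))"
  using assms(2)
proof (induction s arbitrary: k)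
  case 0
  have "(\<Sum>j\<le>K. r_Stirling2 j (0 + j) k * alpha j (edgeless m \<uplus>\<^sub>G H)) =
      (\<Sum>j\<le>K. if k = j then alpha j (edgeless m \<uplus>\<^sub>G H) else 0)"
    \<comment> \<open>The Stirling factor is a Kronecker delta; it selects \<open>j = k\<close>,
      which is in range because \<open>k \<le> K\<close>.\<close>
    by (rule sum.cong) (auto simp: r_Stirling2_self)
  then show ?case using 0 by simp
next
  case (Suc s)
  have "alpha k (edgeless (Suc s + m) \<uplus>\<^sub>G H) =
      k * alpha k (edgeless (s + m) \<uplus>\<^sub>G H) +
      (if k = 0 then 0 else alpha (k - 1) (edgeless (s + m) \<uplus>\<^sub>G H))"
    using alpha_edgeless_Suc[OF assms(1)] by simp
  also have "\<dots> = (\<Sum>j\<le>K. r_Stirling2 j (Suc s + j) k * alpha j (edgeless m \<uplus>\<^sub>G H))"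
    using Suc.IH[of k] Suc.IH[of "k - 1"] Suc.prems
    by (simp add: r_Stirling2_Suc sum.distrib sum_distrib_left algebra_simps)
  finally show ?case .
qed

text \<open>The union with the empty graph is \<open>H\<close> with its vertices tagged by
  \<open>Inr\<close>, so partitions are transported along this injection. It turns the case
  \<open>s = n\<close> into a formula in \<open>alpha j H\<close>.\<close>

lemma alpha_edgeless_0: "alpha k (edgeless 0 \<uplus>\<^sub>G H) = alpha k H"
proof -
  let ?J = "\<lambda>S. \<forall>u\<in>S. \<forall>v\<in>S. (u, v) \<notin> parcs H"
  let ?J' = "\<lambda>S :: (nat + 'a) set. \<forall>u\<in>S. \<forall>v\<in>S. (u, v) \<notin> map_prod Inr Inr ` parcs H"
  let ?f = "image (image Inr) :: 'a set set \<Rightarrow> (nat + 'a) set set"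
  let ?g = "image (vimage Inr) :: (nat + 'a) set set \<Rightarrow> 'a set set"
  have gf: "?g (?f P) = P" for P
    by (simp add: image_image inj_vimage_image_eq)
  have inj: "inj_on (image Inr :: 'a set \<Rightarrow> (nat + 'a) set) P" for P
    by (simp add: inj_on_def inj_image_eq_iff)
  \<comment> \<open>Preimages undo images for every family, but the converse needs all blocks to lie
    in \<open>range Inr\<close>.\<close>
  have fg: "?f (?g Q) = Q" if "\<Union>Q \<subseteq> range Inr" for Q
  proof -
    have "Inr ` (Inr -` S) = S" if "S \<in> Q" for S
      using that \<open>\<Union>Q \<subseteq> range Inr\<close> by (auto simp: image_vimage_eq)
    then show ?thesis by (simp add: image_image)
  qed
  have "bij_betw ?f (partitions_with ?J (pverts H) k) (partitions_with ?J' (Inr ` pverts H) k)"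
  proof (rule bij_betw_byWitness[where f' = ?g])
    show "\<forall>P\<in>partitions_with ?J (pverts H) k. ?g (?f P) = P"
      using gf by blast
    show "\<forall>Q\<in>partitions_with ?J' (Inr ` pverts H) k. ?f (?g Q) = Q"
    proof
      fix Q assume "Q \<in> partitions_with ?J' (Inr ` pverts H) k"
      then have "\<Union>Q \<subseteq> range Inr" by (auto simp: partitions_with_def partition_on_def)
      then show "?f (?g Q) = Q" by (rule fg)
    qed
    show "?f ` partitions_with ?J (pverts H) k \<subseteq> partitions_with ?J' (Inr ` pverts H) k"
    proof clarify
      fix P assume P: "P \<in> partitions_with ?J (pverts H) k"
      then have "partition_on (Inr ` pverts H) (?f P - {{}})"
        by (intro partition_on_inj_image) (auto simp: partitions_with_def)
      \<comment> \<open>This makes the removal of \<open>{}\<close> in the preceding partition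
        vacuous.\<close>
      moreover have "{} \<notin> ?f P"
        using P by (auto simp: partitions_with_def partition_on_def)
      ultimately show "?f P \<in> partitions_with ?J' (Inr ` pverts H) k"
        using P inj[of P] by (auto simp: partitions_with_def card_image)
    qed
    show "?g ` partitions_with ?J' (Inr ` pverts H) k \<subseteq> partitions_with ?J (pverts H) k"
    proof clarify
      fix Q assume Q: "Q \<in> partitions_with ?J' (Inr ` pverts H) k"
      then have sub: "\<Union>Q \<subseteq> range Inr" "{} \<notin> Q"
        by (auto simp: partitions_with_def partition_on_def)
      have "partition_on (Inr -` (Inr ` pverts H :: (nat + 'a) set)) (?g Q - {{}})"
        using Q by (intro partition_on_vimage) (auto simp: partitions_with_def)
      moreover have "{} \<notin> ?g Q"
      proof
        assume "{} \<in> ?g Q"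
        then have "{} \<in> ?f (?g Q)" by blast
        then show False using sub fg by simp
      qed
      \<comment> \<open>\<open>Q\<close> is the image of \<open>?g Q\<close> under the injective map
        \<open>image Inr\<close>.\<close>
      moreover have "card (?g Q) = k"
        using Q fg[OF sub(1)] card_image[OF inj, of "?g Q"] by (simp add: partitions_with_def)
      moreover have "\<forall>S\<in>?g Q. ?J S"
        using Q by (fastforce simp: partitions_with_def)
      ultimately show "?g Q \<in> partitions_with ?J (pverts H) k"
        by (simp add: partitions_with_def inj_vimage_image_eq)
    qed
  qed
  then show ?thesis
    unfolding alpha_eq_card_partitions_with
    by (simp add: disjoint_union_def edgeless_def bij_betw_same_card)
qed

section \<open>Vanishing outside the admissible range of \<open>k\<close>\<close>

lemma alpha_disjoint_union_eq_0:
  assumes "finite (pverts G)" "pair_graph H" "k < chromatic_number H"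
  shows "alpha k (G \<uplus>\<^sub>G H) = 0"
proof -
  interpret H: pair_graph H by fact
  \<comment> \<open>The blocks serve as \<open>k\<close> colours for \<open>H\<close>: each vertex
    gets the number of the block containing its tagged copy. Adjacent vertices lie in different
    blocks, so \<open>chromatic_number H \<le> k\<close>, a contradiction.\<close>
  have False if P: "partition_on (pverts (G \<uplus>\<^sub>G H)) P" "card P = k"
    "\<forall>S\<in>P. independent_set (G \<uplus>\<^sub>G H) S" for P
  proof -
    have "finite P"
      using finite_elements[OF _ P(1)] assms(1) by (simp add: disjoint_union_def)
    then obtain i where i: "bij_betw i P {..<k}"
      using P(2) ex_bij_betw_finite_nat[of P] by (auto simp: lessThan_atLeast0)
    have "\<exists>B. B \<in> P \<and> Inr v \<in> B" if "v \<in> pverts H" for v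
      using partition_onD1[OF P(1)] that by (auto simp: disjoint_union_def)
    then obtain b where b: "\<And>v. v \<in> pverts H \<Longrightarrow> b v \<in> P \<and> Inr v \<in> b v"
      by metis
    have "i (b u) \<noteq> i (b v)" if uv: "(u, v) \<in> parcs H" for u v
    proof
      assume eq: "i (b u) = i (b v)"
      have "u \<in> pverts H" "v \<in> pverts H" using uv by (auto dest: H.wellformed')
      then have "b u = b v" "Inr u \<in> b u" "Inr v \<in> b v" "b u \<in> P"
        using eq b i by (auto simp: bij_betw_def inj_on_def)
      moreover have "(Inr u, Inr v) \<in> parcs (G \<uplus>\<^sub>G H)"
        using uv by (force simp: disjoint_union_def)
      ultimately show False using P(3) unfolding independent_set_def by metis
    qed
    moreover have "i (b v) < k" if "v \<in> pverts H" for v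
      using that b i by (auto simp: bij_betw_def)
    ultimately have "proper_coloring H k (\<lambda>v. i (b v))"
      by (auto simp: proper_coloring_def)
    then have "chromatic_number H \<le> k"
      unfolding chromatic_number_def by (intro Least_le) blast
    then show False using assms(3) by simp
  qed
  then have "{P. partition_on (pverts (G \<uplus>\<^sub>G H)) P \<and> card P = k \<and>
      (\<forall>S\<in>P. independent_set (G \<uplus>\<^sub>G H) S)} = {}" by blast
  then show ?thesis unfolding alpha_def by (simp only: card.empty)
qed

lemma alpha_eq_0_if_card_less:
  assumes "finite (pverts G)" "card (pverts G) < k"
  shows "alpha k G = 0"
proof -
  have "{P. partition_on (pverts G) P \<and> card P = k \<and> (\<forall>S\<in>P. independent_set G S)} = {}"
    using partition_on_card_le[OF assms(1)] assms(2) by fastforce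
  then show ?thesis unfolding alpha_def by (simp only: card.empty)
qed

section \<open>The vanishing range, the sum formula and its special cases\<close>

theorem theorem1:
  fixes H :: "'a pair_pre_digraph" and h n s k :: nat
  assumes "pair_graph H" and "card (pverts H) = h" and "s \<le> n"
  shows "(k < chromatic_number H \<or> k > n + h \<longrightarrow> alpha k (edgeless n \<uplus>\<^sub>G H) = 0) \<and>
    (chromatic_number H \<le> k \<and> k \<le> n + h \<longrightarrow>
       alpha k (edgeless n \<uplus>\<^sub>G H) =
         (\<Sum>j = chromatic_number H..k. r_Stirling2 j (s + j) k * alpha j (edgeless (n - s) \<uplus>\<^sub>G H)) \<and>
       alpha k (edgeless n \<uplus>\<^sub>G H) =
         (\<Sum>j = chromatic_number H..k. r_Stirling2 j (n + j) k * alpha j H) \<and>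
       (n \<ge> 1 \<longrightarrow>
         alpha k (edgeless n \<uplus>\<^sub>G H) =
           k * alpha k (edgeless (n - 1) \<uplus>\<^sub>G H) +
           (if k = 0 then 0 else alpha (k - 1) (edgeless (n - 1) \<uplus>\<^sub>G H))))"
proof -
  interpret H: pair_graph H by fact
  have fin: "finite (pverts H)" by simp
  have low: "alpha j (edgeless m \<uplus>\<^sub>G H) = 0" if "j < chromatic_number H" for j m
    using that assms(1) by (intro alpha_disjoint_union_eq_0) (simp_all add: edgeless_def)
  have high: "alpha k (edgeless n \<uplus>\<^sub>G H) = 0" if "k > n + h"
  proof (rule alpha_eq_0_if_card_less)
    show "finite (pverts (edgeless n \<uplus>\<^sub>G H))"
      by (simp add: disjoint_union_def edgeless_def)
    have "card (pverts (edgeless n \<uplus>\<^sub>G H)) = n + h"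
      unfolding disjoint_union_def edgeless_def using assms(2)
      by (simp, subst card_Un_disjoint) (auto simp: card_image)
    then show "card (pverts (edgeless n \<uplus>\<^sub>G H)) < k" using that by simp
  qed
  have main: "alpha k (edgeless n \<uplus>\<^sub>G H) =
      (\<Sum>j = chromatic_number H..k. r_Stirling2 j (t + j) k * alpha j (edgeless (n - t) \<uplus>\<^sub>G H))"
    if "t \<le> n" for t
  proof -
    \<comment> \<open>Here \<open>K = k\<close>, and \<open>n\<close> is split as
      \<open>t + (n - t)\<close>; the summands below \<open>chromatic_number H\<close> then vanish
      by \<open>low\<close>.\<close>
    have "alpha k (edgeless n \<uplus>\<^sub>G H) =
        (\<Sum>j\<le>k. r_Stirling2 j (t + j) k * alpha j (edgeless (n - t) \<uplus>\<^sub>G H))"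
      using alpha_edgeless_add[OF fin order_refl, of k t "n - t"] that by simp
    also have "\<dots> = (\<Sum>j = chromatic_number H..k.
        r_Stirling2 j (t + j) k * alpha j (edgeless (n - t) \<uplus>\<^sub>G H))"
      by (rule sum.mono_neutral_right) (auto simp: low)
    finally show ?thesis .
  qed
  have "n \<ge> 1 \<longrightarrow> alpha k (edgeless n \<uplus>\<^sub>G H) =
      k * alpha k (edgeless (n - 1) \<uplus>\<^sub>G H) +
      (if k = 0 then 0 else alpha (k - 1) (edgeless (n - 1) \<uplus>\<^sub>G H))"
    using alpha_edgeless_Suc[OF fin, of k "n - 1"] by (cases n) simp_all
  \<comment> \<open>The sums come from \<open>t = s\<close> and \<open>t = n\<close>, the latter
    leaving \<open>edgeless 0\<close>. The recurrence for \<open>s = 1\<close> comes directly from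
    adding one vertex.\<close>
  then show ?thesis
    using low high main[OF assms(3)] main[OF order_refl] by (simp add: alpha_edgeless_0)
qed

end
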